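(* Let $\{a_n\}_{n\ge 0}$ be a periodic sequence of real numbers with minimal odd period $p$ and assume that $0<a_i<2$ for $i=0,\dots,p-1$. Consider the difference equation $$x_{n+1}=x_{n-1}e^{a_n-x_{n-1}-x_n},\qquad n\ge 0. \tag{E}$$ (a) Each solution of (E) with initial values $x_{-1},x_0>0$ converges to a cycle of length $2p$ that depends on the initial values $x_{-1},x_0$. (b) Let $\sigma=\sum_{j=1}^{p}(-1)^j a_{j-1}$. If $x_{-1},x_0>0$ and $x_0=x_{-1}e^{-\sigma/2-x_{-1}}$, then the corresponding solution of (E) converges to a cycle of length $p$.
   Context: A sequence has period $m$ if it is unchanged by the index shift $n\mapsto n+m$; $m$ need not be the minimal period unless "minimal" is stated. A cycle of length $m$ is a solution $\{x_n^*\}$ of (E) having period $m$. A solution $\{x_n\}$ converges to the cycle $\{x_n^*\}$ if $\lim_{n\to\infty}|x_n-x_n^*|=0$. The phrase "depends on the initial values" means that the limiting cycle is allowed to vary with $(x_{-1},x_0)$. *)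

theory Defs
  imports "HOL-Analysis.Analysis"
begin

definition has_period :: "nat \<Rightarrow> (nat \<Rightarrow> real) \<Rightarrow> bool" where
  "has_period m s \<longleftrightarrow> 0 < m \<and> (\<forall>n. s (n + m) = s n)"

definition minimal_period :: "nat \<Rightarrow> (nat \<Rightarrow> real) \<Rightarrow> bool" where
  "minimal_period p s \<longleftrightarrow> has_period p s \<and> (\<forall>m. has_period m s \<longrightarrow> p \<le> m)"

(* A sequence (x_n) with n \<ge> -1 is represented by the function x with x k = x_{k-1};
   so x 0 and x (Suc 0) are the initial values x_{-1} and x_0, and the instance k below is
   x_{k+1} = x_{k-1} exp (a_k - x_{k-1} - x_k).  The parameters are not shifted: a k = a_k. *)
definition is_solution :: "(nat \<Rightarrow> real) \<Rightarrow> (nat \<Rightarrow> real) \<Rightarrow> bool" where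
  "is_solution a x \<longleftrightarrow> (\<forall>k. x (k + 2) = x k * exp (a k - x k - x (k + 1)))"

definition is_cycle :: "(nat \<Rightarrow> real) \<Rightarrow> nat \<Rightarrow> (nat \<Rightarrow> real) \<Rightarrow> bool" where
  "is_cycle a m c \<longleftrightarrow> is_solution a c \<and> has_period m c"

definition converges_to_cycle :: "(nat \<Rightarrow> real) \<Rightarrow> (nat \<Rightarrow> real) \<Rightarrow> bool" where
  "converges_to_cycle x c \<longleftrightarrow> (\<lambda>n. \<bar>x n - c n\<bar>) \<longlonglongrightarrow> 0"

end

theory Submission
  imports Defs
begin

text \<open>
  Sequences are indexed from $0$, so the initial values are $x_0, x_1$ and the equation reads
  $x_{n+2} = x_n \exp (a_n - x_n - x_{n+1})$. For a positive solution $x$ put $s_n = \ln (x_{n+1}/x_n) + x_n$. The equation then says exactly that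
  $s_n + s_{n+1} = a_n$, so $x$ is an orbit of the first-order Ricker equation
  $x_{n+1} = x_n e^{s_n - x_n}$, whose parameters $s_n$ may be large or negative but have
  consecutive sums in $(0,2)$. Since $p$ is odd, $s_{n+p} - s_n$ changes sign under
  a shift by $p$; hence $s$ has period $2p$. The initial condition of the second claim
  says $s_0 = -\sigma/2$, which is the value for which $s_p = s_0$, and then $s$ has period $p$.
  It remains to show that a first-order Ricker equation with $N$-periodic parameters of this kind
  attracts each positive orbit to an $N$-cycle (\<open>periodic_ricker_converges_to_cycle\<close>).

  The reason is contraction. For a fixed sequence $s$ an infinitesimal perturbation
  $\delta_n = d \ln x_n$ evolves by $\delta_{n+1} = (1 - x_n)\,\delta_n$, which may expand for a while. The
  weighted size $|\delta_n| \exp ((x_n^2 + x_{n+1}^2)/8)$, however, always decreases: passing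
  from $n$ to $n+1$ the factor belonging to $x_{n+1}$ is kept, so what is needed is
  \[ |1 - x_n| \exp (x_{n+2}^2/8) \le \exp (x_n^2/8), \]
  and since $x_{n+2} = x_n \exp (a_n - x_n - x_{n+1}) \le x_n e^{2 - x_n}$ this follows from an
  inequality in the single variable $x_n$ (\<open>ricker_weight_inequality\<close>). Its two cases of equality are
  $x_n = 0$ and $x_n = 2$ with $a_n = 2$ and $x_{n+1} = 0$; orbits stay
  away from $0$ and the $a_n$ are bounded away from $2$, so the decrease is geometric.

  Thus two orbits of the same equation approach each other geometrically
  (\<open>ricker_contraction\<close>). When $s$ has period $N$, the shifted sequence $x_{n+N}$ is another such
  orbit, so $x_{n+N} - x_n$ decays geometrically, the limits of $x_{n+kN}$ as $k \to \infty$
  exist, and they form the cycle.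
\<close>

section \<open>A weight that makes the Ricker map contract\<close>

text \<open>
  The derivative of the function is $1 - e^{2t}(1 - 2t)$, which is nonnegative because
  $e^{-2t} \ge 1 - 2t$. As the function vanishes at $0$, this compares $e^{2t}(1-t)$ with $1+t$ in
  opposite directions on the two sides of $0$.
\<close>

lemma mobius_exp_mono:
  fixes s t :: real
  assumes "s \<le> t"
  shows "1 + s - exp (2 * s) * (1 - s) \<le> 1 + t - exp (2 * t) * (1 - t)"
proof (rule DERIV_nonneg_imp_nondecreasing[OF assms])
  fix u :: real
  have "exp (2 * u) * (1 - 2 * u) \<le> exp (2 * u) * exp (- (2 * u))"
    using exp_ge_add_one_self[of "- (2 * u)"] by (intro mult_left_mono) auto
  then have "0 \<le> 1 - exp (2 * u) * (1 - 2 * u)" by (simp add: exp_minus)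
  moreover have "((\<lambda>t. 1 + t - exp (2 * t) * (1 - t)) has_real_derivative
      1 - exp (2 * u) * (1 - 2 * u)) (at u)"
    by (auto intro!: derivative_eq_intros simp: algebra_simps)
  ultimately show "\<exists>y. ((\<lambda>t. 1 + t - exp (2 * t) * (1 - t)) has_real_derivative y) (at u) \<and> 0 \<le> y"
    by blast
qed

text \<open>
  This is $\ln (1 - x) \le - x - x^2/2$ on $[0,1)$, put multiplicatively so that it also covers
  $x \ge 1$. The derivative of the left-hand side is $- x^2 e^{x + x^2/2}$.
\<close>

lemma one_minus_le_exp:
  fixes x :: real
  assumes "0 \<le> x"
  shows "(1 - x) * exp (x + x\<^sup>2/2) \<le> 1"
proof -
  have "(1 - x) * exp (x + x\<^sup>2/2) \<le> (1 - 0) * exp (0 + 0\<^sup>2/2)"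
  proof (rule DERIV_nonpos_imp_nonincreasing[OF assms])
    fix u :: real
    have "((\<lambda>x. (1 - x) * exp (x + x\<^sup>2/2)) has_real_derivative
        - (u\<^sup>2 * exp (u + u\<^sup>2/2))) (at u)"
      by (auto intro!: derivative_eq_intros simp: algebra_simps power2_eq_square)
    moreover have "- (u\<^sup>2 * exp (u + u\<^sup>2/2)) \<le> 0" by simp
    ultimately show "\<exists>y. ((\<lambda>x. (1 - x) * exp (x + x\<^sup>2/2)) has_real_derivative y) (at u) \<and> y \<le> 0"
      by blast
  qed
  then show ?thesis by simp
qed

text \<open>
  The gap is smallest, about $0.2$, near $x = 2/5$. Expanding the exponential there reduces
  the claim to $24.9\, x \le (8 + 5x)(1/5 + 2x)$, a quadratic inequality with negative discriminant;
  $24.9$ is an upper bound of $e^{16/5}$ that is sharp enough.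
\<close>

lemma ricker_square_bound:
  fixes x :: real
  assumes "0 \<le> x"
  shows "x * exp (4 - 2 * x) \<le> 8 + 5 * x"
proof -
  have "exp (16/5 :: real) ^ 5 = exp 1 ^ 16"
    by (simp add: exp_of_nat_mult[symmetric])
  also have "\<dots> \<le> (2.72::real) ^ 16"
    by (intro power_mono) (use e_less_272 in auto)
  also have "\<dots> \<le> 24.9 ^ 5" by (simp add: power_numeral_reduce)
  finally have e: "exp (16/5 :: real) \<le> 24.9"
    by (rule power_mono_iff[THEN iffD1, rotated 3]) auto
  have "x * exp (16/5) \<le> x * 24.9" using assms e by (intro mult_left_mono)
  also have "\<dots> \<le> (8 + 5 * x) * (1/5 + 2 * x)"
    using zero_le_power2[of "10 * x - 79/20"] by (simp add: power2_eq_square algebra_simps)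
  \<comment> \<open>$1/5 + 2x$ is the tangent of $e^{2x - 4/5}$ at $x = 2/5$.\<close>
  also have "\<dots> \<le> (8 + 5 * x) * exp (2 * x - 4/5)"
    using exp_ge_add_one_self[of "2 * x - 4/5"] assms by (intro mult_left_mono) auto
  finally have "x * exp (16/5) * exp (4/5 - 2 * x) \<le> (8 + 5 * x) * exp (2 * x - 4/5) * exp (4/5 - 2 * x)"
    by (intro mult_right_mono) auto
  then show ?thesis by (simp add: mult.assoc exp_add[symmetric])
qed

text \<open>
  The weight $e^{x^2/8}$ is tuned to the Ricker map $g(x) = x e^{2 - x}$ with critical parameter $2$:
  at its fixed point $2$ the derivative is $-1$, so equality holds there, and a weight $e^{r(x)}$ can
  survive to first order only if $r'(2) = 1/2$. The constant $1/8$ in $r(x) = x^2/8$ is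
  dictated by this. To the left of $1$ the claim follows from \<open>ricker_square_bound\<close>;
  to the right, the logarithm of the quotient of both sides is maximal at $2$, where it vanishes.
\<close>

lemma ricker_weight_inequality:
  fixes x :: real
  assumes "0 \<le> x"
  shows "\<bar>1 - x\<bar> * exp (x\<^sup>2 * exp (4 - 2 * x) / 8) \<le> exp (x\<^sup>2 / 8)"
proof (cases "x \<le> 1")
  case True
  have "x * (x * exp (4 - 2 * x)) \<le> x * (8 + 5 * x)"
    using ricker_square_bound[OF assms] assms by (intro mult_left_mono)
  then have "x\<^sup>2 * exp (4 - 2 * x) / 8 \<le> (x + x\<^sup>2/2) + x\<^sup>2 / 8"
    by (simp add: power2_eq_square algebra_simps)
  then have "(1 - x) * exp (x\<^sup>2 * exp (4 - 2 * x) / 8) \<le> (1 - x) * exp ((x + x\<^sup>2/2) + x\<^sup>2 / 8)"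
    using True by (intro mult_left_mono) auto
  also have "\<dots> = (1 - x) * exp (x + x\<^sup>2/2) * exp (x\<^sup>2 / 8)"
    by (simp only: exp_add mult_ac)
  also have "\<dots> \<le> 1 * exp (x\<^sup>2 / 8)"
    using one_minus_le_exp[OF assms] by (intro mult_right_mono) auto
  finally show ?thesis using True by simp
next
  case False
  define h :: "real \<Rightarrow> real" where "h t = ln (t - 1) + t\<^sup>2 * (exp (4 - 2 * t) - 1) / 8" for t
  define h' :: "real \<Rightarrow> real" where
    "h' t = 1 / (t - 1) - t / 4 * (1 + exp (4 - 2 * t) * (t - 1))" for t
  have deriv: "(h has_real_derivative h' t) (at t)" if "1 < t" for t
    unfolding h_def[abs_def] h'_def using that
    by (auto intro!: derivative_eq_intros simp: field_simps power2_eq_square)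
  have h2: "h 2 = 0" by (simp add: h_def)
  have "h x \<le> 0"
  proof (cases "x \<le> 2")
    case True
    have "h x \<le> h 2"
    proof (rule DERIV_nonneg_imp_nondecreasing[OF True, where f = h])
      fix t assume t: "x \<le> t" "t \<le> 2"
      then have t1: "1 < t" using False by simp
      have "exp (4 - 2 * t) * (t - 1) \<le> 3 - t"
        using mobius_exp_mono[of 0 "2 - t"] t by (simp add: algebra_simps)
      then have "t / 4 * (1 + exp (4 - 2 * t) * (t - 1)) \<le> t / 4 * (1 + (3 - t))"
        using t1 by (intro mult_left_mono) auto
      also have "\<dots> \<le> 1" using zero_le_power2[of "t - 2"] by (simp add: power2_eq_square algebra_simps)
      also have "\<dots> \<le> 1 / (t - 1)" using t1 t by simp
      finally show "\<exists>y. (h has_real_derivative y) (at t) \<and> 0 \<le> y"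
        using deriv[OF t1] by (auto simp: h'_def)
    qed
    then show ?thesis using h2 by simp
  next
    case x2: False
    then have "2 \<le> x" by simp
    have "h x \<le> h 2"
    proof (rule DERIV_nonpos_imp_nonincreasing[OF \<open>2 \<le> x\<close>, where f = h])
      fix t assume t: "2 \<le> t" "t \<le> x"
      then have t1: "1 < t" by simp
      have "1 / (t - 1) \<le> t / 4 * (1 + exp (4 - 2 * t) * (t - 1))"
      proof (cases "t \<le> 3")
        case True
        have "(t - 2) * (3 - t) \<ge> 0" "(t-2)*(t-2) \<ge> 0" "(t-2)*(t-2)*(3-t) \<ge> 0"
          using True t by auto
        then have "4 \<le> t * (4 - t) * (t - 1)"
          by (simp add: algebra_simps)
        then have "1 / (t - 1) \<le> t / 4 * (1 + (3 - t))"
          using t1 by (simp add: field_simps)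
        also have "3 - t \<le> exp (4 - 2 * t) * (t - 1)"
          using mobius_exp_mono[of "2 - t" 0] t by (simp add: algebra_simps)
        then have "t / 4 * (1 + (3 - t)) \<le> t / 4 * (1 + exp (4 - 2 * t) * (t - 1))"
          using t1 by (intro mult_left_mono) auto
        finally show ?thesis .
      next
        case t3: False
        \<comment> \<open>The lower bound $3 - t$ is too weak for large $t$, but from $3$ on $t/4$ alone is large enough.\<close>
        have "3 * t \<le> t * t" using t3 by (intro mult_right_mono) auto
        then have "t + 4 \<le> t * t" using t3 by linarith
        then have "1 / (t - 1) \<le> t / 4 * (1 + 0)" using t3 by (simp add: field_simps)
        also have "\<dots> \<le> t / 4 * (1 + exp (4 - 2 * t) * (t - 1))"
          using t1 by (intro mult_left_mono add_left_mono) auto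
        finally show ?thesis .
      qed
      then show "\<exists>y. (h has_real_derivative y) (at t) \<and> y \<le> 0"
        using deriv[OF t1] by (auto simp: h'_def)
    qed
    then show ?thesis using h2 by simp
  qed
  then have "ln (x - 1) + x\<^sup>2 * exp (4 - 2 * x) / 8 \<le> x\<^sup>2 / 8"
    by (simp add: h_def algebra_simps diff_divide_distrib)
  then have "exp (ln (x - 1) + x\<^sup>2 * exp (4 - 2 * x) / 8) \<le> exp (x\<^sup>2 / 8)"
    by simp
  then show ?thesis using False by (simp add: exp_add)
qed

text \<open>
  When $z \le x e^{A - x}$ with $A < 2$, the square $z^2$ falls short of the critical value
  $x^2 e^{4 - 2x}$ by $x^2 e^{-2x}(e^4 - e^{2A})$. On $[m, B]$ this is at least $8\kappa$, which
  turns the weak inequality into a uniform contraction.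
\<close>

lemma weighted_contraction_step:
  fixes x z m B A :: real
  assumes x: "0 < m" "m \<le> x" "x \<le> B" and z: "0 \<le> z" "z \<le> x * exp (A - x)" and A: "A < 2"
  defines "\<kappa> \<equiv> m\<^sup>2 * exp (- 2 * B) * (exp 4 - exp (2 * A)) / 8"
  shows "\<bar>1 - x\<bar> * exp (z\<^sup>2 / 8) \<le> exp (- \<kappa>) * exp (x\<^sup>2 / 8)"
proof -
  have "z\<^sup>2 \<le> (x * exp (A - x))\<^sup>2" using z by (intro power_mono)
  also have "\<dots> = x\<^sup>2 * exp (4 - 2 * x) - x\<^sup>2 * exp (- 2 * x) * (exp 4 - exp (2 * A))"
    by (simp add: power_mult_distrib exp_double[symmetric] exp_diff exp_minus field_simps)
  also have "\<dots> \<le> x\<^sup>2 * exp (4 - 2 * x) - m\<^sup>2 * exp (- 2 * B) * (exp 4 - exp (2 * A))"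
  proof -
    have "m\<^sup>2 * exp (- 2 * B) \<le> x\<^sup>2 * exp (- 2 * x)"
      using x by (intro mult_mono power_mono) auto
    then show ?thesis using A by (intro diff_left_mono mult_right_mono) auto
  qed
  finally have "z\<^sup>2 / 8 \<le> x\<^sup>2 * exp (4 - 2 * x) / 8 + - \<kappa>"
    by (simp add: \<kappa>_def)
  then have "exp (z\<^sup>2 / 8) \<le> exp (x\<^sup>2 * exp (4 - 2 * x) / 8 + - \<kappa>)" by simp
  then have "\<bar>1 - x\<bar> * exp (z\<^sup>2 / 8) \<le> \<bar>1 - x\<bar> * exp (x\<^sup>2 * exp (4 - 2 * x) / 8 + - \<kappa>)"
    by (intro mult_left_mono) auto
  also have "\<dots> = exp (- \<kappa>) * (\<bar>1 - x\<bar> * exp (x\<^sup>2 * exp (4 - 2 * x) / 8))"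
    by (simp only: exp_add mult_ac)
  also have "\<dots> \<le> exp (- \<kappa>) * exp (x\<^sup>2 / 8)"
    using ricker_weight_inequality[of x] x by (intro mult_left_mono) auto
  finally show ?thesis .
qed

text \<open>
  The product is the factor by which an infinitesimal perturbation of $\ln x_0$ has grown after
  $n$ steps. Only its weighted version shrinks at every step; as the weights lie between $1$
  and $e^{B^2/4}$, they affect the constant but not the rate.
\<close>

lemma prod_one_minus_decay:
  fixes x :: "nat \<Rightarrow> real"
  assumes x: "0 < m" "\<And>n. m \<le> x n" "\<And>n. x n \<le> B"
    and step: "\<And>n. x (n + 2) \<le> x n * exp (A - x n)" and A: "A < 2"
  defines "\<kappa> \<equiv> m\<^sup>2 * exp (- 2 * B) * (exp 4 - exp (2 * A)) / 8"
  shows "(\<Prod>i<n. \<bar>1 - x i\<bar>) \<le> exp (- \<kappa>) ^ n * exp (B\<^sup>2 / 4)"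
proof -
  have pos: "0 \<le> x k" for k using x(1) x(2)[of k] by simp
  \<comment> \<open>In one step the weight of \<open>x (n + 1)\<close> is kept, and that of \<open>x n\<close> is replaced by that of \<open>x (n + 2)\<close>.\<close>
  have weighted: "(\<Prod>i<n. \<bar>1 - x i\<bar>) * exp ((x n)\<^sup>2 / 8 + (x (n + 1))\<^sup>2 / 8)
        \<le> exp (- \<kappa>) ^ n * exp ((x 0)\<^sup>2 / 8 + (x 1)\<^sup>2 / 8)"
  proof (induction n)
    case (Suc n)
    have "\<bar>1 - x n\<bar> * exp ((x (n + 2))\<^sup>2 / 8) \<le> exp (- \<kappa>) * exp ((x n)\<^sup>2 / 8)"
      unfolding \<kappa>_def using x step A pos by (intro weighted_contraction_step) auto
    then have "((\<Prod>i<n. \<bar>1 - x i\<bar>) * exp ((x (n + 1))\<^sup>2 / 8)) * (\<bar>1 - x n\<bar> * exp ((x (n + 2))\<^sup>2 / 8))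
        \<le> ((\<Prod>i<n. \<bar>1 - x i\<bar>) * exp ((x (n + 1))\<^sup>2 / 8)) * (exp (- \<kappa>) * exp ((x n)\<^sup>2 / 8))"
      by (intro mult_left_mono mult_nonneg_nonneg prod_nonneg) auto
    also have "\<dots> = exp (- \<kappa>) * ((\<Prod>i<n. \<bar>1 - x i\<bar>) * exp ((x n)\<^sup>2 / 8 + (x (n + 1))\<^sup>2 / 8))"
      by (simp add: exp_add)
    also have "\<dots> \<le> exp (- \<kappa>) * (exp (- \<kappa>) ^ n * exp ((x 0)\<^sup>2 / 8 + (x 1)\<^sup>2 / 8))"
      by (intro mult_left_mono Suc) auto
    finally show ?case by (simp add: exp_add mult_ac)
  qed simp
  have "(\<Prod>i<n. \<bar>1 - x i\<bar>) * 1 \<le> (\<Prod>i<n. \<bar>1 - x i\<bar>) * exp ((x n)\<^sup>2 / 8 + (x (n + 1))\<^sup>2 / 8)"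
    by (intro mult_left_mono prod_nonneg) auto
  also note weighted
  also have "exp (- \<kappa>) ^ n * exp ((x 0)\<^sup>2 / 8 + (x 1)\<^sup>2 / 8) \<le> exp (- \<kappa>) ^ n * exp (B\<^sup>2 / 4)"
  proof -
    have "(x k)\<^sup>2 \<le> B\<^sup>2" for k using x(3)[of k] pos[of k] by (intro power_mono)
    from this[of 0] this[of 1] show ?thesis by (intro mult_left_mono) auto
  qed
  finally show ?thesis by simp
qed

section \<open>Nonautonomous Ricker equations whose consecutive parameters have sums below two\<close>

primrec ricker :: "(nat \<Rightarrow> real) \<Rightarrow> nat \<Rightarrow> real \<Rightarrow> real" where
  "ricker s 0 u = u"
| "ricker s (Suc n) u = ricker s n u * exp (s n - ricker s n u)"

lemma ricker_pos: "0 < u \<Longrightarrow> 0 < ricker s n u"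
  by (induction n) auto

text \<open>
  Two steps together see only the sum of two consecutive parameters, so bounds on these sums
  control the orbit along indices of the same parity.
\<close>

lemma ricker_two_step:
  "ricker s (n + 2) u
     = ricker s n u * exp (s n + s (Suc n) - ricker s n u - ricker s (Suc n) u)"
  by (simp add: exp_add[symmetric] mult.assoc algebra_simps)

text \<open>The map $x \mapsto x e^{s - x}$ attains its maximum $e^{s - 1}$ at $1$.\<close>

lemma ricker_le:
  assumes S: "\<And>n. s n \<le> S" and u: "0 < u" "u \<le> B" and B: "exp (S - 1) \<le> B"
  shows "ricker s n u \<le> B"
proof (cases n)
  case (Suc k)
  let ?x = "ricker s k u"
  have "?x * exp (s k - ?x) \<le> exp (?x - 1) * exp (s k - ?x)"
    using exp_ge_add_one_self[of "?x - 1"] by (intro mult_right_mono) auto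
  also have "\<dots> = exp (s k - 1)" by (simp add: exp_add[symmetric])
  also have "\<dots> \<le> exp (S - 1)" using S by simp
  finally show ?thesis using Suc B by simp
qed (use u in simp)

text \<open>
  If $x_n \le \epsilon = \alpha / (1 + e^S)$, then $x_n + x_{n+1} \le x_n (1 + e^S) \le \alpha$, so the exponent
  in the two-step recursion is nonnegative and $x_{n+2} \ge x_n$. If $x_n > \epsilon$, then
  $x_{n+2} \ge \epsilon e^{-2B}$. Hence small values cannot decrease along indices of the same parity.
\<close>

lemma ricker_ge:
  assumes S: "\<And>n. \<bar>s n\<bar> \<le> S" and \<alpha>: "0 < \<alpha>" "\<And>n. \<alpha> \<le> s n + s (Suc n)"
    and l: "0 < l" "l \<le> u" "u \<le> B" and B: "exp (S - 1) \<le> B"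
  shows "min (l * exp (- S - B)) (\<alpha> / (1 + exp S) * exp (- 2 * B)) \<le> ricker s n u"
proof -
  define \<epsilon> where "\<epsilon> = \<alpha> / (1 + exp S)"
  define m where "m = min (l * exp (- S - B)) (\<epsilon> * exp (- 2 * B))"
  have "0 < 1 + exp S" by (simp add: add_pos_pos)
  then have \<epsilon>: "0 < \<epsilon>" "\<epsilon> * (1 + exp S) = \<alpha>" using \<alpha>(1) by (simp_all add: \<epsilon>_def)
  have pos: "0 < ricker s k u" for k using l by (intro ricker_pos) simp
  have s: "- S \<le> s k" "s k \<le> S" for k using S[of k] by auto
  have le: "ricker s k u \<le> B" for k
    using ricker_le[of s S u B k] s l B by auto
  have S0: "0 \<le> S" using S[of 0] by simp
  have B0: "0 < B" using B exp_gt_zero[of "S - 1"] by linarith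
  have step: "m \<le> ricker s (k + 2) u" if m: "m \<le> ricker s k u" for k
  proof (cases "ricker s k u \<le> \<epsilon>")
    case True
    let ?x = "ricker s k u"
    have "?x * exp (s k - ?x) \<le> ?x * exp S"
      using pos[of k] s[of k] by (intro mult_left_mono) auto
    then have "?x + ricker s (Suc k) u \<le> ?x * (1 + exp S)" by (simp add: algebra_simps)
    also have "\<dots> \<le> \<epsilon> * (1 + exp S)" using True by (intro mult_right_mono) (auto simp: add_nonneg_nonneg)
    also have "\<dots> \<le> s k + s (Suc k)" using \<epsilon> \<alpha> by simp
    finally have "?x * 1 \<le> ricker s (k + 2) u"
      unfolding ricker_two_step using pos[of k] by (intro mult_left_mono) auto
    then show ?thesis using m by simp
  next
    case False
    have "\<epsilon> * exp (- 2 * B) \<le> ricker s (k + 2) u"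
      unfolding ricker_two_step
      using False \<epsilon> pos[of k] le[of k] le[of "Suc k"] \<alpha>(1) \<alpha>(2)[of k] by (intro mult_mono) auto
    then show ?thesis by (simp add: m_def)
  qed
  have "m \<le> ricker s k u \<and> m \<le> ricker s (Suc k) u" for k
  proof (induction k)
    case 0
    have "l * exp (- S - B) \<le> u * exp (s 0 - u)"
      using l s(1)[of 0] by (intro mult_mono) auto
    moreover have "l * exp (- S - B) \<le> u * 1"
      using l S0 B0 by (intro mult_mono) auto
    ultimately show ?case by (auto simp: m_def min_def)
  next
    case (Suc k)
    then show ?case using step[of k] by simp
  qed
  then show ?thesis by (simp add: m_def \<epsilon>_def)
qed

text \<open>
  In logarithmic coordinates the derivative of $x \mapsto x e^{s - x}$ is $1 - x$, whatever the
  parameter is. The chain rule multiplies these factors, and the quotient in front translates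
  back from logarithmic coordinates.
\<close>

lemma ricker_has_derivative:
  assumes "u \<noteq> 0"
  shows "(ricker s n has_real_derivative ricker s n u / u * (\<Prod>i<n. 1 - ricker s i u)) (at u)"
proof (induction n)
  case 0
  have "(ricker s 0) = (\<lambda>u. u)" by auto
  then show ?case using assms by simp
next
  case (Suc n)
  have "ricker s (Suc n) = (\<lambda>u. ricker s n u * exp (s n - ricker s n u))" by auto
  then show ?case
    by (auto intro!: derivative_eq_intros Suc simp: algebra_simps)
qed

text \<open>
  The bounds on the orbit hold uniformly over all initial values in a compact interval of positive
  numbers, so the derivative of the $n$-th iterate decays geometrically and uniformly there. The mean
  value theorem then compares two orbits.
\<close>

lemma ricker_contraction:
  assumes S: "\<And>n. \<bar>s n\<bar> \<le> S"
    and \<alpha>: "0 < \<alpha>" "\<And>n. \<alpha> \<le> s n + s (Suc n)"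
    and A: "A < 2" "\<And>n. s n + s (Suc n) \<le> A"
    and l: "0 < l"
  obtains C q where "0 < q" "q < 1"
    "\<And>n u v. u \<in> {l..r} \<Longrightarrow> v \<in> {l..r} \<Longrightarrow> \<bar>ricker s n u - ricker s n v\<bar> \<le> C * q ^ n * \<bar>u - v\<bar>"
proof -
  define B where "B = max r (exp (S - 1))"
  define m where "m = min (l * exp (- S - B)) (\<alpha> / (1 + exp S) * exp (- 2 * B))"
  define \<kappa> where "\<kappa> = m\<^sup>2 * exp (- 2 * B) * (exp 4 - exp (2 * A)) / 8"
  have m: "0 < m" using l \<alpha>(1) by (simp add: m_def add_pos_pos)
  have \<kappa>: "0 < \<kappa>" using m A(1) by (simp add: \<kappa>_def)
  have s: "s k \<le> S" for k using S[of k] by auto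
  have bound: "\<bar>ricker s n u / u * (\<Prod>i<n. 1 - ricker s i u)\<bar> \<le> B / l * exp (B\<^sup>2/4) * exp (- \<kappa>) ^ n"
    if u: "u \<in> {l..r}" for n u
  proof -
    have B: "u \<le> B" "exp (S - 1) \<le> B" using u by (auto simp: B_def)
    have pos: "0 < ricker s k u" for k using u l by (intro ricker_pos) simp
    have le: "ricker s k u \<le> B" for k using ricker_le[of s S u B k] s u l B by auto
    have ge: "m \<le> ricker s k u" for k
      unfolding m_def using u B by (intro ricker_ge S \<alpha> l) auto
    have step: "ricker s (k + 2) u \<le> ricker s k u * exp (A - ricker s k u)" for k
      unfolding ricker_two_step using pos[of k] pos[of "Suc k"] A(2)[of k]
      by (intro mult_left_mono) (auto simp del: ricker.simps)
    have "(\<Prod>i<n. \<bar>1 - ricker s i u\<bar>) \<le> exp (- \<kappa>) ^ n * exp (B\<^sup>2 / 4)"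
      unfolding \<kappa>_def by (rule prod_one_minus_decay[where x = "\<lambda>k. ricker s k u", OF m ge le step A(1)])
    moreover have "ricker s n u / u \<le> B / l"
      using le[of n] pos[of n] u l by (intro frac_le) auto
    ultimately have "ricker s n u / u * (\<Prod>i<n. \<bar>1 - ricker s i u\<bar>)
        \<le> B / l * (exp (- \<kappa>) ^ n * exp (B\<^sup>2 / 4))"
      using pos[of n] le[of n] u l by (intro mult_mono prod_nonneg divide_nonneg_nonneg) auto
    then show ?thesis using pos[of n] u l by (simp add: abs_mult abs_prod mult_ac)
  qed
  show thesis
  proof
    show "0 < exp (- \<kappa>)" "exp (- \<kappa>) < 1" using \<kappa> by auto
    fix n u v assume uv: "u \<in> {l..r}" "v \<in> {l..r}"
    have "norm (ricker s n u - ricker s n v) \<le> B / l * exp (B\<^sup>2/4) * exp (- \<kappa>) ^ n * norm (u - v)"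
    proof (rule field_differentiable_bound[where S = "{l..r}"])
      fix w assume w: "w \<in> {l..r}"
      then show "(ricker s n has_field_derivative ricker s n w / w * (\<Prod>i<n. 1 - ricker s i w))
          (at w within {l..r})"
        using l by (intro ricker_has_derivative[THEN has_field_derivative_at_within]) auto
      show "norm (ricker s n w / w * (\<Prod>i<n. 1 - ricker s i w))
          \<le> B / l * exp (B\<^sup>2/4) * exp (- \<kappa>) ^ n"
        using bound[OF w] by simp
    qed (use uv in auto)
    then show "\<bar>ricker s n u - ricker s n v\<bar> \<le> B / l * exp (B\<^sup>2/4) * exp (- \<kappa>) ^ n * \<bar>u - v\<bar>"
      by simp
  qed
qed

section \<open>Convergence to a cycle under periodic parameters\<close>

text \<open>
  Along each residue class modulo $N$ the increments are dominated by a geometric series, so the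
  limits exist; the sum of the remaining increments bounds the distance to the limit by a multiple
  of $q^n$, which makes the convergence uniform over the residue classes.
\<close>

lemma geometric_asymptotic_period_limit:
  fixes x :: "nat \<Rightarrow> real"
  assumes q: "0 < q" "q < 1" and N: "0 < N" and x: "\<And>n. \<bar>x (n + N) - x n\<bar> \<le> K * q ^ n"
  obtains c where "has_period N c" "\<And>n. (\<lambda>k. x (n + k * N)) \<longlonglongrightarrow> c n" "converges_to_cycle x c"
proof -
  define d where "d n k = x (n + Suc k * N) - x (n + k * N)" for n k
  define c where "c n = x n + (\<Sum>k. d n k)" for n
  have r: "0 \<le> q ^ N" "q ^ N < 1" using q N by (auto simp: power_less_one_iff)
  have d: "\<bar>d n k\<bar> \<le> K * q ^ n * (q ^ N) ^ k" for n k
  proof -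
    have "d n k = x (n + k * N + N) - x (n + k * N)" by (simp add: d_def algebra_simps)
    then show ?thesis using x[of "n + k * N"] by (simp add: power_add power_mult mult_ac)
  qed
  have geo: "summable (\<lambda>k. K * q ^ n * (q ^ N) ^ k)" for n
    using r by (intro summable_mult summable_geometric) simp
  have sd: "summable (d n)" for n
    by (rule summable_comparison_test'[OF geo[of n], of 0]) (use d in auto)
  have tele: "x (n + k * N) = x n + (\<Sum>i<k. d n i)" for n k
    using sum_lessThan_telescope[of "\<lambda>i. x (n + i * N)" k] unfolding d_def by simp
  have lim: "(\<lambda>k. x (n + k * N)) \<longlonglongrightarrow> c n" for n
    unfolding tele c_def by (intro tendsto_intros summable_LIMSEQ sd)
  have "c (n + N) = c n" for n
  proof -
    have "(\<lambda>k. x (n + Suc k * N)) \<longlonglongrightarrow> c n"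
      using lim[of n] by (rule LIMSEQ_Suc)
    then have "(\<lambda>k. x (n + N + k * N)) \<longlonglongrightarrow> c n" by (simp add: algebra_simps)
    with lim[of "n + N"] show ?thesis by (rule LIMSEQ_unique)
  qed
  then have per: "has_period N c" using N by (simp add: has_period_def)
  have tail: "\<bar>x n - c n\<bar> \<le> K / (1 - q ^ N) * q ^ n" for n
  proof -
    have "norm (\<Sum>k. d n k) \<le> (\<Sum>k. K * q ^ n * (q ^ N) ^ k)"
      using d by (intro norm_suminf_le geo) auto
    also have "\<dots> = K * q ^ n * (1 / (1 - q ^ N))"
      using r by (subst suminf_mult) (auto intro!: summable_geometric simp: suminf_geometric)
    finally show ?thesis by (simp add: c_def)
  qed
  have "(\<lambda>n. K / (1 - q ^ N) * q ^ n) \<longlonglongrightarrow> 0"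
    using q by (intro tendsto_mult_right_zero LIMSEQ_realpow_zero) auto
  then have "(\<lambda>n. \<bar>x n - c n\<bar>) \<longlonglongrightarrow> 0"
    by (rule Lim_null_comparison[rotated]) (rule always_eventually, use tail in simp)
  then show thesis using that per lim by (simp add: converges_to_cycle_def)
qed

lemma has_period_mod:
  assumes "has_period N s"
  shows "s (n mod N) = s n"
proof -
  have "s (k + j * N) = s k" for k j
    using assms by (induction j) (auto simp: has_period_def add.assoc[symmetric] add.commute[of N])
  from this[of "n mod N" "n div N"] show ?thesis by simp
qed

lemma has_period_finite_range:
  assumes "has_period N s"
  shows "finite (range s)"
proof (rule finite_subset)
  have "0 < N" using assms by (simp add: has_period_def)
  then show "range s \<subseteq> s ` {..<N}"
    using has_period_mod[OF assms] by (metis image_iff image_subsetI lessThan_iff mod_less_divisor)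
qed simp

text \<open>
  The orbit is compared with its own shift by $N$. Periodicity makes the bounds required by
  \<open>ricker_contraction\<close> uniform, since $s$ takes finitely many values. That the limit again
  solves the equation follows by continuity along the indices $n + kN$, at all of which the
  parameter is $s_n$.
\<close>

lemma periodic_ricker_converges_to_cycle:
  assumes per: "has_period N s" and sums: "\<And>n. 0 < s n + s (Suc n)" "\<And>n. s n + s (Suc n) < 2"
    and x0: "0 < x 0" and x: "\<And>n. x (Suc n) = x n * exp (s n - x n)"
  obtains c where "has_period N c" "\<And>n. c (Suc n) = c n * exp (s n - c n)" "converges_to_cycle x c"
proof -
  define a where "a n = s n + s (Suc n)" for n
  have N: "0 < N" and sN: "s (n + N) = s n" for n using per by (auto simp: has_period_def)
  have "has_period N a" using N sN sN[of "Suc n" for n] by (simp add: has_period_def a_def)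
  then have fin: "finite (range a)" by (rule has_period_finite_range)
  have fs: "finite (range (\<lambda>n. \<bar>s n\<bar>))"
    using has_period_finite_range[OF per] by (simp add: finite_imageI flip: image_image)
  \<comment> \<open>Both the orbit and its shift by a period solve the same equation, with initial values \<open>x 0\<close> and \<open>x N\<close>.\<close>
  have flow: "x n = ricker s n (x 0)" for n
    by (induction n) (simp_all add: x)
  have shifted: "x (n + N) = ricker s n (x N)" for n
    by (induction n) (simp_all add: x sN)
  have pos: "0 < x n" for n by (subst flow) (rule ricker_pos[OF x0])
  have "Min (range a) \<in> range a" "Max (range a) \<in> range a" using fin by auto
  then have min: "0 < Min (range a)" and max: "Max (range a) < 2" using sums by (auto simp: a_def)
  have min_le: "Min (range a) \<le> s n + s (Suc n)" for n
    unfolding a_def[symmetric] using fin by simp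
  have le_max: "s n + s (Suc n) \<le> Max (range a)" for n
    unfolding a_def[symmetric] using fin by simp
  have s_le: "\<bar>s n\<bar> \<le> Max (range (\<lambda>n. \<bar>s n\<bar>))" for n using fs by auto
  define l r where "l = min (x 0) (x N)" and "r = max (x 0) (x N)"
  have l: "0 < l" and mem: "x 0 \<in> {l..r}" "x N \<in> {l..r}" using x0 pos[of N] by (auto simp: l_def r_def)
  obtain C q where q: "0 < q" "q < 1" and contr:
    "\<And>n u v. u \<in> {l..r} \<Longrightarrow> v \<in> {l..r} \<Longrightarrow> \<bar>ricker s n u - ricker s n v\<bar> \<le> C * q ^ n * \<bar>u - v\<bar>"
    by (rule ricker_contraction[where s = s and r = r, OF s_le min min_le max le_max l]) (rule that)
  have "\<bar>x (n + N) - x n\<bar> \<le> C * \<bar>x N - x 0\<bar> * q ^ n" for n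
    using contr[OF mem(2,1), of n] by (simp add: shifted flow[of n, symmetric] mult_ac)
  from geometric_asymptotic_period_limit[OF q N this]
  obtain c where c: "has_period N c" "\<And>n. (\<lambda>k. x (n + k * N)) \<longlonglongrightarrow> c n" "converges_to_cycle x c"
    by blast
  have "c (Suc n) = c n * exp (s n - c n)" for n
  proof (rule LIMSEQ_unique)
    have "s (n + k * N) = s n" for k
      using has_period_mod[OF per, of "n + k * N"] has_period_mod[OF per, of n] by simp
    then have "x (Suc n + k * N) = x (n + k * N) * exp (s n - x (n + k * N))" for k
      by (simp add: x)
    then show "(\<lambda>k. x (n + k * N) * exp (s n - x (n + k * N))) \<longlonglongrightarrow> c (Suc n)"
      using c(2)[of "Suc n"] by simp
    show "(\<lambda>k. x (n + k * N) * exp (s n - x (n + k * N))) \<longlonglongrightarrow> c n * exp (s n - c n)"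
      by (intro tendsto_intros c(2))
  qed
  then show thesis using that c by blast
qed

section \<open>Reduction of the second-order equation\<close>

text \<open>
  The parameters of the unique first-order Ricker equation that has the positive sequence $x$ as
  an orbit.
\<close>

definition ricker_param :: "(nat \<Rightarrow> real) \<Rightarrow> nat \<Rightarrow> real" where
  "ricker_param x n = ln (x (Suc n) / x n) + x n"

lemma is_solution_pos:
  assumes "is_solution a x" "0 < x 0" "0 < x 1"
  shows "0 < x n"
proof -
  have "0 < x n \<and> 0 < x (Suc n)"
  proof (induction n)
    case (Suc n)
    then show ?case using assms(1)[unfolded is_solution_def, rule_format, of n] by simp
  qed (use assms in auto)
  then show ?thesis by simp
qed

lemma ricker_param_step:
  assumes "\<And>n. 0 < x n"
  shows "x (Suc n) = x n * exp (ricker_param x n - x n)"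
  using assms[of n] assms[of "Suc n"] by (simp add: ricker_param_def)

text \<open>
  The second-order equation solved for its parameter is
  $a_n = \ln (x_{n+2} / x_n) + x_n + x_{n+1}$; splitting the quotient at $x_{n+1}$ gives the two summands.
\<close>

lemma ricker_param_sum:
  assumes "is_solution a x" and pos: "\<And>n. 0 < x n"
  shows "ricker_param x n + ricker_param x (Suc n) = a n"
proof -
  have "x (Suc (Suc n)) = x n * exp (a n - x n - x (Suc n))"
    using assms(1)[unfolded is_solution_def, rule_format, of n] by simp
  then have "ln (x (Suc (Suc n))) = ln (x n) + (a n - x n - x (Suc n))"
    using pos[of n] by (simp add: ln_mult)
  then show ?thesis
    using pos[of n] pos[of "Suc n"] pos[of "Suc (Suc n)"] by (simp add: ricker_param_def ln_div)
qed

lemma is_solutionI_ricker: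
  assumes "\<And>n. c (Suc n) = c n * exp (s n - c n)" "\<And>n. s n + s (Suc n) = a n"
  shows "is_solution a c"
  unfolding is_solution_def
proof
  fix k
  have "c (k + 2) = c k * exp (s k - c k) * exp (s (Suc k) - c (Suc k))"
    using assms(1)[of "Suc k"] assms(1)[of k] by simp
  also have "\<dots> = c k * exp (a k - c k - c (k + 1))"
    by (simp add: assms(2)[symmetric] exp_add[symmetric] mult.assoc algebra_simps)
  finally show "c (k + 2) = c k * exp (a k - c k - c (k + 1))" .
qed

lemma solution_converges_to_cycle:
  assumes sol: "is_solution a x" "0 < x 0" "0 < x 1" and a: "\<And>n. 0 < a n" "\<And>n. a n < 2"
    and per: "has_period N (ricker_param x)"
  shows "\<exists>c. is_cycle a N c \<and> converges_to_cycle x c"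
proof -
  have pos: "\<And>n. 0 < x n" using is_solution_pos[OF sol] .
  note sums = ricker_param_sum[OF sol(1) pos]
  have step: "x (Suc n) = x n * exp (ricker_param x n - x n)" for n
    using pos by (rule ricker_param_step)
  have "0 < ricker_param x n + ricker_param x (Suc n)"
    "ricker_param x n + ricker_param x (Suc n) < 2" for n
    unfolding sums by (rule a)+
  from periodic_ricker_converges_to_cycle[where x = x, OF per this sol(2) step]
  obtain c where c: "has_period N c" "\<And>n. c (Suc n) = c n * exp (ricker_param x n - c n)"
      "converges_to_cycle x c"
    by blast
  have "is_solution a c" by (rule is_solutionI_ricker[where s = "ricker_param x", OF c(2) sums])
  then show ?thesis using c by (auto simp: is_cycle_def)
qed

lemma pair_sum_shift_difference:
  fixes s a :: "nat \<Rightarrow> real"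
  assumes sums: "\<And>n. s n + s (Suc n) = a n" and per: "\<And>n. a (n + p) = a n"
  shows "s (n + p) - s n = (-1) ^ n * (s p - s 0)"
proof (induction n)
  case (Suc n)
  have "s (Suc n + p) - s (Suc n) = - (s (n + p) - s n)"
    using sums[of n] sums[of "n + p"] per[of n] by simp
  then show ?case using Suc by simp
qed simp

text \<open>
  By \<open>pair_sum_shift_difference\<close> the difference $s_{n+p} - s_n$ alternates in sign with $n$, so for odd
  $p$ the increments over two successive blocks of length $p$ cancel.
\<close>

lemma pair_sum_odd_period:
  fixes s a :: "nat \<Rightarrow> real"
  assumes sums: "\<And>n. s n + s (Suc n) = a n" and per: "has_period p a" and p: "odd p"
  shows "has_period (2 * p) s"
proof -
  have "a (n + p) = a n" for n using per by (simp add: has_period_def)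
  note diff = pair_sum_shift_difference[OF sums this]
  have "s (n + 2 * p) = s n" for n
    using diff[of n] diff[of "n + p"] p by (simp add: power_add mult_2 add.assoc)
  then show ?thesis using per by (simp add: has_period_def)
qed

lemma pair_sum_alternating:
  fixes s a :: "nat \<Rightarrow> real"
  assumes sums: "\<And>n. s n + s (Suc n) = a n"
  shows "(-1) ^ n * s n = s 0 + (\<Sum>j=1..n. (-1) ^ j * a (j - 1))"
proof (induction n)
  case (Suc n)
  have "(-1) ^ Suc n * s (Suc n) = (-1) ^ n * s n + (-1) ^ Suc n * a n"
    by (simp add: sums[symmetric] algebra_simps)
  then show ?case using Suc by simp
qed simp

theorem corollary9:
  fixes a :: "nat \<Rightarrow> real" and p :: nat and \<sigma> :: real
  assumes "minimal_period p a"
    and "odd p"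
    and "\<forall>i<p. 0 < a i \<and> a i < 2"
    and "\<sigma> = (\<Sum>j=1..p. (-1) ^ j * a (j - 1))"
  shows "(\<forall>x. is_solution a x \<and> 0 < x 0 \<and> 0 < x 1 \<longrightarrow>
            (\<exists>c. is_cycle a (2 * p) c \<and> converges_to_cycle x c)) \<and>
         (\<forall>x. is_solution a x \<and> 0 < x 0 \<and> 0 < x 1 \<and> x 1 = x 0 * exp (- \<sigma> / 2 - x 0) \<longrightarrow>
            (\<exists>c. is_cycle a p c \<and> converges_to_cycle x c))"
proof -
  have per: "has_period p a" using assms(1) by (simp add: minimal_period_def)
  then have p: "0 < p" and ap: "a (n + p) = a n" for n by (auto simp: has_period_def)
  have a: "0 < a n" "a n < 2" for n
    using assms(3)[rule_format, of "n mod p"] has_period_mod[OF per, of n] p by auto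
  have "\<exists>c. is_cycle a (2 * p) c \<and> converges_to_cycle x c"
    if sol: "is_solution a x" "0 < x 0" "0 < x 1" for x
    using sol a pair_sum_odd_period[OF ricker_param_sum[OF sol(1) is_solution_pos[OF sol]] per assms(2)]
    by (intro solution_converges_to_cycle)
  moreover have "\<exists>c. is_cycle a p c \<and> converges_to_cycle x c"
    if sol: "is_solution a x" "0 < x 0" "0 < x 1" and x1: "x 1 = x 0 * exp (- \<sigma> / 2 - x 0)" for x
  proof -
    let ?s = "ricker_param x"
    note sums = ricker_param_sum[OF sol(1) is_solution_pos[OF sol]]
    \<comment> \<open>As $p$ is odd, the alternating sum gives \<open>?s p = - ?s 0 - \<sigma>\<close>, whose fixed point is $-\sigma/2$.\<close>
    have "?s 0 = - \<sigma> / 2" using x1 sol by (simp add: ricker_param_def)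
    moreover have "- ?s p = ?s 0 + \<sigma>"
      using pair_sum_alternating[where s = ?s and n = p, OF sums] assms(2,4) by simp
    ultimately have "?s p = ?s 0" by simp
    then have "has_period p ?s"
      using pair_sum_shift_difference[where s = ?s, OF sums ap] p by (simp add: has_period_def)
    then show ?thesis using sol a by (intro solution_converges_to_cycle)
  qed
  ultimately show ?thesis by blast
qed

end
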